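(* Let $\mathcal{M}$ be a complete Riemannian manifold with Riemannian distance $\rho$, let $\mathcal{X}$ be a set, $n\ge 1$, and let $f:\mathcal{X}^n\to\mathcal{M}$ be a summary with global sensitivity $\Delta$ (with respect to $\rho$), $0<\Delta<\infty$. Let $\epsilon>0$. For $\sigma>0$, the Laplace mechanism with rate $\sigma$ releases, for each dataset $D\in\mathcal{X}^n$, a random element $\widetilde f(D)$ of $\mathcal{M}$ drawn from the Laplace distribution on $\mathcal{M}$ with footpoint $f(D)$ and rate $\sigma$ (assumed to be well defined, i.e. the normalizing constants $C_{f(D),\sigma}$ are finite). Then the Laplace mechanism with rate $\sigma = 2\Delta/\epsilon$ satisfies $\epsilon$-differential privacy. Moreover, if the normalizing constant $C_{\eta,\sigma}$ does not depend on the footpoint $\eta$, then one can take $\sigma=\Delta/\epsilon$, i.e. the Laplace mechanism with rate $\sigma=\Delta/\epsilon$ satisfies $\epsilon$-differential privacy.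
   Context: $\mathcal{M}$ is a $d$-dimensional complete (connected) Riemannian manifold equipped with its Borel $\sigma$-algebra; $\rho$ is the distance induced by the Riemannian metric and $\mu$ is the Riemannian volume measure. Datasets: $D=\{x_1,\dots,x_n\}$ with $x_i\in\mathcal{X}$, viewed as an element of $\mathcal{X}^n$. Two datasets $D,D'\in\mathcal{X}^n$ are adjacent, written $D\sim D'$, if they differ in only one record. $\epsilon$-differential privacy: a family of randomized summaries $\{\widetilde f(D)\in\mathcal{M}: D\in\mathcal{X}^n\}$ is $\epsilon$-differentially private if for all adjacent $D\sim D'$ and all measurable sets $A\subseteq\mathcal{M}$, $P(\widetilde f(D)\in A)\le e^{\epsilon}P(\widetilde f(D')\in A)$. Global sensitivity: $f$ has global sensitivity $\Delta<\infty$ with respect to $\rho$ if $\rho(f(D),f(D'))\le\Delta$ for all adjacent $D\sim D'$. Laplace distribution: a probability measure $P$ on $\mathcal{M}$ is a Laplace distribution with footpoint $\eta\in\mathcal{M}$ and rate $\sigma>0$ if for every measurable $A$, $P(A)=\int_A C_{\eta,\sigma}^{-1}e^{-\rho(\eta,m)/\sigma}\,d\mu(m)$, where $C_{\eta,\sigma}=\int_{\mathcal{M}}e^{-\rho(\eta,m)/\sigma}\,d\mu(m)$ is the normalizing constant, with $0<C_{\eta,\sigma}<\infty$. *)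

theory Defs
  imports "HOL-Probability.Probability"
begin

text \<open>
  \<open>C\<^sup>k\<close> and smooth functions; used on open sets only, where this is the usual notion. The recursive
  clause says that \<open>f\<close> is differentiable with all partial derivatives of class \<open>C\<^sup>k\<close>.
\<close>

primrec Ck_on ::
    "nat \<Rightarrow> 'e::euclidean_space set \<Rightarrow> ('e \<Rightarrow> 'b::real_normed_vector) \<Rightarrow> bool" where
  "Ck_on 0 S f \<longleftrightarrow> continuous_on S f"
| "Ck_on (Suc k) S f \<longleftrightarrow>
     (\<forall>x\<in>S. f differentiable at x) \<and>
     (\<forall>b\<in>Basis. Ck_on k S (\<lambda>x. frechet_derivative f (at x) b))"

definition smooth_on :: "'e::euclidean_space set \<Rightarrow> ('e \<Rightarrow> 'b::real_normed_vector) \<Rightarrow> bool" where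
  "smooth_on S f \<longleftrightarrow> (\<forall>k. Ck_on k S f)"

text \<open>
  The underlying set of the manifold is the whole type \<open>'a\<close>, with the topology of its type class
  instance. A chart is a pair \<open>(U, \<phi>)\<close>; the values of \<open>\<phi>\<close> outside \<open>U\<close> are irrelevant.
\<close>

type_synonym ('a, 'n) chart = "'a set \<times> ('a \<Rightarrow> real ^ 'n)"

text \<open>
  A Riemannian metric is given by its coordinate matrices: \<open>g (U, \<phi>) p\<close> is the Gram matrix, at the
  point \<open>p \<in> U\<close> of the manifold, of the coordinate frame of the chart \<open>(U, \<phi>)\<close>. The transformation
  law of covariant 2-tensors says that these matrices describe one inner product on the tangent
  space at \<open>p\<close>.
\<close>

type_synonym ('a, 'n) metric_coords = "('a, 'n) chart \<Rightarrow> 'a \<Rightarrow> real ^ 'n ^ 'n"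

locale riemannian_manifold =
  fixes charts :: "('a::{t2_space, second_countable_topology}, 'n::finite) chart set"
    and g :: "('a, 'n) metric_coords"
  assumes charts_cover: "(\<Union>(U, \<phi>)\<in>charts. U) = UNIV"
    and chart_homeo: "(U, \<phi>) \<in> charts \<Longrightarrow>
      open U \<and> open (\<phi> ` U) \<and> homeomorphism U (\<phi> ` U) \<phi> (inv_into U \<phi>)"
    and transition_smooth: "(U, \<phi>) \<in> charts \<Longrightarrow> (V, \<psi>) \<in> charts \<Longrightarrow>
      smooth_on (\<phi> ` (U \<inter> V)) (\<psi> \<circ> inv_into U \<phi>)"
    and metric_smooth: "(U, \<phi>) \<in> charts \<Longrightarrow> smooth_on (\<phi> ` U) (g (U, \<phi>) \<circ> inv_into U \<phi>)"
    and metric_symmetric: "(U, \<phi>) \<in> charts \<Longrightarrow> p \<in> U \<Longrightarrow>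
      transpose (g (U, \<phi>) p) = g (U, \<phi>) p"
    and metric_pos_def: "(U, \<phi>) \<in> charts \<Longrightarrow> p \<in> U \<Longrightarrow> v \<noteq> 0 \<Longrightarrow>
      v \<bullet> (g (U, \<phi>) p *v v) > 0"
    and metric_transform: "(U, \<phi>) \<in> charts \<Longrightarrow> (V, \<psi>) \<in> charts \<Longrightarrow> p \<in> U \<inter> V \<Longrightarrow>
      (let J = jacobian (\<psi> \<circ> inv_into U \<phi>) (at (\<phi> p))
       in g (U, \<phi>) p = transpose J ** g (V, \<psi>) p ** J)"
    and connected_manifold: "connected (UNIV :: 'a set)"

definition C1_curve_on ::
    "('a::topological_space, 'n::finite) chart set \<Rightarrow> real \<Rightarrow> real \<Rightarrow> (real \<Rightarrow> 'a) \<Rightarrow> bool" where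
  "C1_curve_on charts a b \<gamma> \<longleftrightarrow>
     continuous_on {a..b} \<gamma> \<and>
     (\<forall>(U, \<phi>)\<in>charts. \<exists>\<gamma>'. continuous_on {t\<in>{a..b}. \<gamma> t \<in> U} \<gamma>' \<and>
        (\<forall>t\<in>{t\<in>{a..b}. \<gamma> t \<in> U}.
          ((\<phi> \<circ> \<gamma>) has_vector_derivative \<gamma>' t) (at t within {a..b})))"

text \<open>
  In contrast to \<^const>\<open>piecewise_C1_differentiable_on\<close>, the pieces have to be continuously
  differentiable up to their (one-sided) end points, so that all curves below have finite length
  and the integral in the definition of the length is never a junk value.
\<close>

definition piecewise_C1_curve ::
    "('a::topological_space, 'n::finite) chart set \<Rightarrow> (real \<Rightarrow> 'a) \<Rightarrow> bool" where
  "piecewise_C1_curve charts \<gamma> \<longleftrightarrow>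
     (\<exists>k s. s 0 = 0 \<and> s k = 1 \<and>
        (\<forall>i<k::nat. s i < s (Suc i) \<and> C1_curve_on charts (s i) (s (Suc i)) \<gamma>))"

text \<open>
  The Riemannian norm of the velocity at time \<open>t\<close>. By the transformation law it does not depend on
  the chart selected; at the finitely many break points of \<open>\<gamma>\<close> its value is irrelevant.
\<close>

definition curve_speed ::
    "('a::topological_space, 'n::finite) chart set \<Rightarrow> ('a, 'n) metric_coords \<Rightarrow>
     (real \<Rightarrow> 'a) \<Rightarrow> real \<Rightarrow> real" where
  "curve_speed charts g \<gamma> t =
     (let (U, \<phi>) = (SOME (U, \<phi>). (U, \<phi>) \<in> charts \<and> \<gamma> t \<in> U);
          v = vector_derivative (\<phi> \<circ> \<gamma>) (at t)
      in sqrt (v \<bullet> (g (U, \<phi>) (\<gamma> t) *v v)))"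

definition curve_length ::
    "('a::topological_space, 'n::finite) chart set \<Rightarrow> ('a, 'n) metric_coords \<Rightarrow>
     (real \<Rightarrow> 'a) \<Rightarrow> real" where
  "curve_length charts g \<gamma> = integral {0..1} (curve_speed charts g \<gamma>)"

definition riemannian_dist ::
    "('a::topological_space, 'n::finite) chart set \<Rightarrow> ('a, 'n) metric_coords \<Rightarrow>
     'a \<Rightarrow> 'a \<Rightarrow> real" where
  "riemannian_dist charts g x y =
     Inf {curve_length charts g \<gamma> | \<gamma>. piecewise_C1_curve charts \<gamma> \<and> \<gamma> 0 = x \<and> \<gamma> 1 = y}"

definition complete_riemannian_manifold ::
    "('a::{t2_space, second_countable_topology}, 'n::finite) chart set \<Rightarrow>
     ('a, 'n) metric_coords \<Rightarrow> bool" where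
  "complete_riemannian_manifold charts g \<longleftrightarrow>
     riemannian_manifold charts g \<and> Metric_space.mcomplete UNIV (riemannian_dist charts g)"

text \<open>
  The volume measure is the Borel measure with \<open>d\<mu> = sqrt (det g) dx\<close> in every chart. As countably
  many charts cover the manifold, this determines \<open>\<mu>\<close>.
\<close>

definition riemannian_volume ::
    "('a::topological_space, 'n::finite) chart set \<Rightarrow> ('a, 'n) metric_coords \<Rightarrow>
     'a measure \<Rightarrow> bool" where
  "riemannian_volume charts g \<mu> \<longleftrightarrow>
     sets \<mu> = sets borel \<and>
     (\<forall>(U, \<phi>)\<in>charts. \<forall>B\<in>sets borel. B \<subseteq> U \<longrightarrow>
        emeasure \<mu> B =
          (\<integral>\<^sup>+x\<in>\<phi> ` B. ennreal (sqrt (det (g (U, \<phi>) (inv_into U \<phi> x)))) \<partial>lborel))"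

definition datasets :: "'x set \<Rightarrow> nat \<Rightarrow> (nat \<Rightarrow> 'x) set" where
  "datasets X n = {..<n} \<rightarrow>\<^sub>E X"

definition adjacent :: "nat \<Rightarrow> (nat \<Rightarrow> 'x) \<Rightarrow> (nat \<Rightarrow> 'x) \<Rightarrow> bool" where
  "adjacent n D D' \<longleftrightarrow> (\<exists>!i. i < n \<and> D i \<noteq> D' i)"

definition has_global_sensitivity ::
    "('a \<Rightarrow> 'a \<Rightarrow> real) \<Rightarrow> 'x set \<Rightarrow> nat \<Rightarrow> ((nat \<Rightarrow> 'x) \<Rightarrow> 'a) \<Rightarrow> real \<Rightarrow> bool" where
  "has_global_sensitivity \<rho> X n f \<Delta> \<longleftrightarrow>
     (\<forall>D\<in>datasets X n. \<forall>D'\<in>datasets X n. adjacent n D D' \<longrightarrow> \<rho> (f D) (f D') \<le> \<Delta>)"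

text \<open>
  A randomized summary is a family of random elements \<open>F D\<close> of the manifold, each defined on a
  probability space \<open>\<Omega> D\<close> of its own.
\<close>

definition randomized_summary ::
    "'x set \<Rightarrow> nat \<Rightarrow> ((nat \<Rightarrow> 'x) \<Rightarrow> 'w measure) \<Rightarrow>
     ((nat \<Rightarrow> 'x) \<Rightarrow> 'w \<Rightarrow> 'a::topological_space) \<Rightarrow> bool" where
  "randomized_summary X n \<Omega> F \<longleftrightarrow>
     (\<forall>D\<in>datasets X n. prob_space (\<Omega> D) \<and> F D \<in> \<Omega> D \<rightarrow>\<^sub>M borel)"

definition differentially_private ::
    "real \<Rightarrow> 'x set \<Rightarrow> nat \<Rightarrow> ((nat \<Rightarrow> 'x) \<Rightarrow> 'w measure) \<Rightarrow>
     ((nat \<Rightarrow> 'x) \<Rightarrow> 'w \<Rightarrow> 'a::topological_space) \<Rightarrow> bool" where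
  "differentially_private \<epsilon> X n \<Omega> F \<longleftrightarrow>
     randomized_summary X n \<Omega> F \<and>
     (\<forall>D\<in>datasets X n. \<forall>D'\<in>datasets X n. adjacent n D D' \<longrightarrow>
       (\<forall>A\<in>sets borel.
          \<P>(\<omega> in \<Omega> D. F D \<omega> \<in> A) \<le> exp \<epsilon> * \<P>(\<omega> in \<Omega> D'. F D' \<omega> \<in> A)))"

definition laplace_const ::
    "('a \<Rightarrow> 'a \<Rightarrow> real) \<Rightarrow> 'a measure \<Rightarrow> 'a \<Rightarrow> real \<Rightarrow> ennreal" where
  "laplace_const \<rho> \<mu> \<eta> \<sigma> = (\<integral>\<^sup>+m. ennreal (exp (- \<rho> \<eta> m / \<sigma>)) \<partial>\<mu>)"

definition laplace_distribution ::
    "('a::topological_space \<Rightarrow> 'a \<Rightarrow> real) \<Rightarrow> 'a measure \<Rightarrow> 'a \<Rightarrow> real \<Rightarrow> 'a measure \<Rightarrow> bool" where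
  "laplace_distribution \<rho> \<mu> \<eta> \<sigma> P \<longleftrightarrow>
     prob_space P \<and> sets P = sets borel \<and>
     0 < laplace_const \<rho> \<mu> \<eta> \<sigma> \<and> laplace_const \<rho> \<mu> \<eta> \<sigma> < \<infinity> \<and>
     (\<forall>A\<in>sets borel. emeasure P A =
        (\<integral>\<^sup>+m\<in>A. inverse (laplace_const \<rho> \<mu> \<eta> \<sigma>) * ennreal (exp (- \<rho> \<eta> m / \<sigma>)) \<partial>\<mu>))"

definition laplace_mechanism ::
    "('a::topological_space \<Rightarrow> 'a \<Rightarrow> real) \<Rightarrow> 'a measure \<Rightarrow> 'x set \<Rightarrow> nat \<Rightarrow>
     ((nat \<Rightarrow> 'x) \<Rightarrow> 'a) \<Rightarrow> real \<Rightarrow> ((nat \<Rightarrow> 'x) \<Rightarrow> 'w measure) \<Rightarrow>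
     ((nat \<Rightarrow> 'x) \<Rightarrow> 'w \<Rightarrow> 'a) \<Rightarrow> bool" where
  "laplace_mechanism \<rho> \<mu> X n f \<sigma> \<Omega> F \<longleftrightarrow>
     randomized_summary X n \<Omega> F \<and>
     (\<forall>D\<in>datasets X n. laplace_distribution \<rho> \<mu> (f D) \<sigma> (distr (\<Omega> D) borel (F D)))"

end

theory Submission
  imports Defs
begin

text \<open>
  By the triangle inequality, moving the footpoint of a Laplace density by at most \<open>\<Delta>\<close> changes the
  unnormalized density \<open>exp (- \<rho> \<eta> m / \<sigma>)\<close> by a factor of at most \<open>exp (\<Delta> / \<sigma>)\<close>, at every \<open>m\<close>.
  Integrating over the manifold, the normalizing constant changes by at most the same factor. The
  normalized densities at two adjacent datasets therefore differ by a factor of at most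
  \<open>exp (2 * \<Delta> / \<sigma>)\<close>, and of at most \<open>exp (\<Delta> / \<sigma>)\<close> if the constant is the same at all footpoints;
  with the two choices of \<open>\<sigma>\<close> this factor is \<open>exp \<epsilon>\<close>
  (\<open>laplace_const_le\<close>, \<open>laplace_distribution_le\<close>, \<open>laplace_mechanism_differentially_private\<close>).

  The geometric input is the triangle inequality for the Riemannian distance
  (\<open>riemannian_dist_triangle\<close>), an infimum of curve lengths. Two facts about piecewise
  \<open>C\<^sup>1\<close> curves give it: any two points are joined by one
  (\<open>piecewise_C1_connected\<close>), so that the infimum ranges over a nonempty set, and the length of
  a concatenation is at most the sum of the lengths (\<open>curve_length_join_le\<close>).
  The first holds because coordinate segments join the points of a coordinate ball, curves can be
  concatenated, and the manifold is connected.
\<close>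

section \<open>Piecewise continuously differentiable curves\<close>

lemma C1_curve_on_affine:
  assumes \<gamma>: "C1_curve_on charts a b \<gamma>"
    and m: "m > 0" and ends: "m * a' + c = a" "m * b' + c = b"
    and \<delta>: "\<And>t. t \<in> {a'..b'} \<Longrightarrow> \<delta> t = \<gamma> (m * t + c)"
  shows "C1_curve_on charts a' b' \<delta>"
proof -
  let ?h = "\<lambda>t. m * t + c"
  have h: "?h t \<in> {a..b}" if "t \<in> {a'..b'}" for t
    using that m ends by (auto simp: mult_left_mono)
  have hcont: "continuous_on T ?h" for T by (intro continuous_intros)
  have "continuous_on {a'..b'} (\<gamma> \<circ> ?h)"
    using \<gamma> h by (intro continuous_on_compose hcont) (auto simp: C1_curve_on_def intro: continuous_on_subset)
  then have cont: "continuous_on {a'..b'} \<delta>"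
    by (rule continuous_on_eq) (simp add: \<delta>)
  have "\<exists>\<delta>'. continuous_on {t\<in>{a'..b'}. \<delta> t \<in> U} \<delta>' \<and>
        (\<forall>t\<in>{t\<in>{a'..b'}. \<delta> t \<in> U}.
          ((\<phi> \<circ> \<delta>) has_vector_derivative \<delta>' t) (at t within {a'..b'}))"
    if chart: "(U, \<phi>) \<in> charts" for U \<phi>
  proof -
    obtain \<gamma>' where g: "continuous_on {t\<in>{a..b}. \<gamma> t \<in> U} \<gamma>'"
      and d: "\<And>t. t\<in>{t\<in>{a..b}. \<gamma> t \<in> U} \<Longrightarrow>
          ((\<phi> \<circ> \<gamma>) has_vector_derivative \<gamma>' t) (at t within {a..b})"
      using bspec[OF conjunct2[OF \<gamma>[unfolded C1_curve_on_def]] chart] by auto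
    have sub: "?h ` {t\<in>{a'..b'}. \<delta> t \<in> U} \<subseteq> {t\<in>{a..b}. \<gamma> t \<in> U}"
      using h \<delta> by auto
    have "continuous_on {t\<in>{a'..b'}. \<delta> t \<in> U} (\<gamma>' \<circ> ?h)"
      by (intro continuous_on_compose hcont continuous_on_subset[OF g sub])
    then have "continuous_on {t\<in>{a'..b'}. \<delta> t \<in> U} (\<lambda>t. m *\<^sub>R \<gamma>' (?h t))"
      by (intro continuous_intros) (simp add: o_def)
    moreover have "((\<phi> \<circ> \<delta>) has_vector_derivative m *\<^sub>R \<gamma>' (?h t)) (at t within {a'..b'})"
      if t: "t\<in>{t\<in>{a'..b'}. \<delta> t \<in> U}" for t
    proof -
      have 1: "(?h has_vector_derivative m) (at t within {a'..b'})"
        by (auto intro!: derivative_eq_intros simp: has_real_derivative_iff_has_vector_derivative[symmetric])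
      have 2: "((\<phi> \<circ> \<gamma>) has_vector_derivative \<gamma>' (?h t)) (at (?h t) within ?h ` {a'..b'})"
      proof (rule has_vector_derivative_within_subset)
        show "((\<phi> \<circ> \<gamma>) has_vector_derivative \<gamma>' (?h t)) (at (?h t) within {a..b})"
          using sub t by (intro d) blast
        show "?h ` {a'..b'} \<subseteq> {a..b}" using h by blast
      qed
      have "((\<phi> \<circ> \<gamma>) \<circ> ?h has_vector_derivative m *\<^sub>R \<gamma>' (?h t)) (at t within {a'..b'})"
        by (rule vector_diff_chain_within[OF 1 2])
      then show ?thesis
        by (rule has_vector_derivative_transform[rotated 2]) (use t \<delta> in auto)
    qed
    ultimately show ?thesis by blast
  qed
  with cont show ?thesis unfolding C1_curve_on_def by blast
qed

lemma joinpaths_second_half: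
  assumes "\<gamma>1 1 = \<gamma>2 0" "t \<ge> 1 / 2"
  shows "(\<gamma>1 +++ \<gamma>2) t = \<gamma>2 (2 * t + - 1)"
proof (cases "t = 1 / 2")
  case True
  show ?thesis unfolding True using assms(1) by (simp add: joinpaths_def)
qed (use assms(2) in \<open>simp add: joinpaths_def\<close>)

lemma piecewise_C1_curve_join:
  assumes \<gamma>1: "piecewise_C1_curve charts \<gamma>1" and \<gamma>2: "piecewise_C1_curve charts \<gamma>2"
    and join: "\<gamma>1 1 = \<gamma>2 0"
  shows "piecewise_C1_curve charts (\<gamma>1 +++ \<gamma>2)"
proof -
  obtain k1 s1 where 1: "s1 0 = 0" "s1 k1 = 1"
    and s1: "\<And>i. i < k1 \<Longrightarrow> s1 i < s1 (Suc i)" "\<And>i. i < k1 \<Longrightarrow> C1_curve_on charts (s1 i) (s1 (Suc i)) \<gamma>1"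
    using \<gamma>1 unfolding piecewise_C1_curve_def by blast
  obtain k2 s2 where 2: "s2 0 = 0" "s2 k2 = 1"
    and s2: "\<And>i. i < k2 \<Longrightarrow> s2 i < s2 (Suc i)" "\<And>i. i < k2 \<Longrightarrow> C1_curve_on charts (s2 i) (s2 (Suc i)) \<gamma>2"
    using \<gamma>2 unfolding piecewise_C1_curve_def by blast
  have up1: "s1 i \<le> 1" if "i \<le> k1" for i
    using that by (induction rule: inc_induct) (use 1 s1 in force)+
  have lo2: "0 \<le> s2 i" if "i \<le> k2" for i
    using that
  proof (induction i)
    case (Suc i)
    then show ?case using s2(1)[of i] by simp
  qed (use 2 in simp)
  \<comment> \<open>Halving and shifting maps the two partitions of \<open>[0, 1]\<close> to partitions of the two halves.\<close>
  define s where "s i = (if i \<le> k1 then s1 i / 2 else (1 + s2 (i - k1)) / 2)" for i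
  have s_lo: "s i = s1 i / 2" if "i \<le> k1" for i
    using that by (simp add: s_def)
  have s_hi: "s (k1 + j) = (1 + s2 j) / 2" for j
    using 1 2 by (cases j) (auto simp: s_def)
  have pieces: "s i < s (Suc i) \<and> C1_curve_on charts (s i) (s (Suc i)) (\<gamma>1 +++ \<gamma>2)"
    if i: "i < k1 + k2" for i
  proof (cases "i < k1")
    case True
    have "C1_curve_on charts (s1 i / 2) (s1 (Suc i) / 2) (\<gamma>1 +++ \<gamma>2)"
      by (rule C1_curve_on_affine[OF s1(2)[OF True], of 2 _ 0])
        (use up1[of "Suc i"] True in \<open>auto simp: joinpaths_def\<close>)
    then show ?thesis using True s1(1)[OF True] by (simp add: s_lo)
  next
    case False
    then obtain j where j: "i = k1 + j" "j < k2"
      using i by (metis add_less_cancel_left le_Suc_ex not_less)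
    have eq: "(\<gamma>1 +++ \<gamma>2) t = \<gamma>2 (2 * t + - 1)" if "t \<in> {(1 + s2 j) / 2..(1 + s2 (Suc j)) / 2}" for t
    proof -
      have "t \<ge> 1 / 2" using that lo2[of j] j by (auto simp: field_simps)
      then show ?thesis by (rule joinpaths_second_half[where ?\<gamma>1.0 = \<gamma>1 and ?\<gamma>2.0 = \<gamma>2, OF join])
    qed
    have "C1_curve_on charts ((1 + s2 j) / 2) ((1 + s2 (Suc j)) / 2) (\<gamma>1 +++ \<gamma>2)"
      by (rule C1_curve_on_affine[OF s2(2)[OF j(2)], of 2 _ "-1"])
        (use eq in \<open>auto simp: field_simps\<close>)
    moreover have "s i = (1 + s2 j) / 2" "s (Suc i) = (1 + s2 (Suc j)) / 2"
      using s_hi[of j] s_hi[of "Suc j"] j by auto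
    moreover have "(1 + s2 j) / 2 < (1 + s2 (Suc j)) / 2"
      using s2(1)[OF j(2)] by simp
    ultimately show ?thesis by (simp only: simp_thms)
  qed
  have "s 0 = 0" "s (k1 + k2) = 1"
    using s_lo[of 0] s_hi[of k2] 1 2 by auto
  with pieces show ?thesis unfolding piecewise_C1_curve_def by blast
qed

lemma partition_point_in_open_piece:
  fixes s :: "nat \<Rightarrow> real"
  assumes "s 0 \<le> t" "t \<le> s k" "t \<notin> s ` {..k}"
  shows "\<exists>i<k. s i < t \<and> t < s (Suc i)"
  using assms
proof (induction k)
  case 0
  then show ?case by auto
next
  case (Suc k)
  show ?case
  proof (cases "t \<le> s k")
    case True
    with Suc.prems have "t \<notin> s ` {..k}" by auto
    with Suc True obtain i where "i < k" "s i < t" "t < s (Suc i)" by blast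
    then show ?thesis by (auto intro: less_SucI)
  next
    case False
    then show ?thesis using Suc.prems by (intro exI[of _ k]) (auto simp: less_le)
  qed
qed

lemma piecewise_C1_curve_differentiable:
  assumes "piecewise_C1_curve charts \<gamma>"
  obtains S where "finite S"
    "\<And>t U \<phi>. t \<in> {0..1} - S \<Longrightarrow> (U, \<phi>) \<in> charts \<Longrightarrow> \<gamma> t \<in> U \<Longrightarrow>
      ((\<phi> \<circ> \<gamma>) has_vector_derivative vector_derivative (\<phi> \<circ> \<gamma>) (at t)) (at t)"
proof -
  obtain k s where s: "s 0 = 0" "s k = 1"
    and C1: "\<And>i. i < k \<Longrightarrow> C1_curve_on charts (s i) (s (Suc i)) \<gamma>"
    using assms unfolding piecewise_C1_curve_def by blast
  show ?thesis
  proof (rule that)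
    show "finite (s ` {..k})" by simp
    fix t U \<phi>
    assume t: "t \<in> {0..1} - s ` {..k}" and U: "(U, \<phi>) \<in> charts" "\<gamma> t \<in> U"
    obtain i where i: "i < k" "s i < t" "t < s (Suc i)"
      using partition_point_in_open_piece[of s t k] t s by auto
    obtain \<gamma>' where "((\<phi> \<circ> \<gamma>) has_vector_derivative \<gamma>') (at t within {s i..s (Suc i)})"
      using C1[OF i(1)] U i unfolding C1_curve_on_def by fastforce
    then have "((\<phi> \<circ> \<gamma>) has_vector_derivative \<gamma>') (at t)"
      using i by (simp add: at_within_Icc_at)
    then show "((\<phi> \<circ> \<gamma>) has_vector_derivative vector_derivative (\<phi> \<circ> \<gamma>) (at t)) (at t)"
      by (simp add: vector_derivative_at)
  qed
qed

section \<open>Joining points by curves\<close>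

text \<open>
  Read in another chart \<open>(V, \<psi>)\<close>, a coordinate segment is the image of a straight segment under the
  transition map \<open>\<psi> \<circ> \<phi>\<^sup>-\<^sup>1\<close>. Its velocity is a derivative of this map in a fixed direction,
  hence a fixed linear combination of the continuous partial derivatives.
\<close>

lemma (in riemannian_manifold) coordinate_segment_C1:
  assumes U: "(U, \<phi>) \<in> charts" and ab: "a \<in> U" "b \<in> U"
    and seg: "closed_segment (\<phi> a) (\<phi> b) \<subseteq> \<phi> ` U"
  shows "\<exists>\<gamma>. piecewise_C1_curve charts \<gamma> \<and> \<gamma> 0 = a \<and> \<gamma> 1 = b"
proof -
  define d where "d = \<phi> b - \<phi> a"
  define l where "l t = \<phi> a + t *\<^sub>R d" for t :: real
  let ?inv = "inv_into U \<phi>"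
  let ?\<gamma> = "?inv \<circ> l"
  have homeo: "homeomorphism U (\<phi> ` U) \<phi> ?inv" using chart_homeo[OF U] by blast
  have l: "l t \<in> \<phi> ` U" if "t \<in> {0..1}" for t
  proof -
    have "l t = (1 - t) *\<^sub>R \<phi> a + t *\<^sub>R \<phi> b" by (simp add: l_def d_def algebra_simps)
    then have "l t \<in> closed_segment (\<phi> a) (\<phi> b)"
      using that unfolding closed_segment_def by auto
    with seg show ?thesis by blast
  qed
  have lcont: "continuous_on T l" for T unfolding l_def by (intro continuous_intros)
  have lderiv: "(l has_vector_derivative d) (at t within T)" for t T
    unfolding l_def by (auto intro!: derivative_eq_intros)
  have "continuous_on {0..1} ?\<gamma>"
    using l homeo by (intro continuous_on_compose lcont)
      (auto simp: homeomorphism_def intro: continuous_on_subset)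
  moreover have "\<exists>\<gamma>'. continuous_on {t\<in>{0..1}. ?\<gamma> t \<in> V} \<gamma>' \<and>
        (\<forall>t\<in>{t\<in>{0..1}. ?\<gamma> t \<in> V}.
          ((\<psi> \<circ> ?\<gamma>) has_vector_derivative \<gamma>' t) (at t within {0..1}))"
    if V: "(V, \<psi>) \<in> charts" for V \<psi>
  proof -
    let ?T = "\<psi> \<circ> ?inv" and ?W = "\<phi> ` (U \<inter> V)"
    let ?D = "\<lambda>x. frechet_derivative ?T (at x)"
    have "Ck_on (Suc 0) ?W ?T"
      using transition_smooth[OF U V] unfolding smooth_on_def by blast
    then have diff: "\<And>x. x \<in> ?W \<Longrightarrow> ?T differentiable at x"
      and partial: "\<And>e. e \<in> Basis \<Longrightarrow> continuous_on ?W (\<lambda>x. ?D x e)"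
      by auto
    have D: "(?T has_derivative ?D x) (at x)" if "x \<in> ?W" for x
      using diff[OF that] by (simp only: frechet_derivative_works)
    have lW: "l t \<in> ?W" if "t \<in> {t\<in>{0..1}. ?\<gamma> t \<in> V}" for t
    proof -
      have "l t = \<phi> (?\<gamma> t)" "?\<gamma> t \<in> U"
        using l[of t] that by (auto simp: f_inv_into_f inv_into_into)
      with that show ?thesis by blast
    qed
    have expand: "?D x d = (\<Sum>e\<in>Basis. (d \<bullet> e) *\<^sub>R ?D x e)" if "x \<in> ?W" for x
    proof -
      interpret bounded_linear "?D x" using D[OF that] by (rule has_derivative_bounded_linear)
      have "?D x d = ?D x (\<Sum>e\<in>Basis. (d \<bullet> e) *\<^sub>R e)" by (simp add: euclidean_representation)
      then show ?thesis by (simp add: sum scale)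
    qed
    have "continuous_on ?W (\<lambda>x. ?D x d)"
      by (subst continuous_on_cong[OF refl expand])
        (auto intro!: continuous_intros partial)
    then have "continuous_on {t\<in>{0..1}. ?\<gamma> t \<in> V} ((\<lambda>x. ?D x d) \<circ> l)"
      using lW by (intro continuous_on_compose lcont) (auto intro: continuous_on_subset)
    then have cont: "continuous_on {t\<in>{0..1}. ?\<gamma> t \<in> V} (\<lambda>t. ?D (l t) d)"
      by (simp add: o_def)
    have deriv: "((\<psi> \<circ> ?\<gamma>) has_vector_derivative ?D (l t) d) (at t within {0..1})"
      if "t \<in> {t\<in>{0..1}. ?\<gamma> t \<in> V}" for t
      using vector_derivative_diff_chain_within[OF lderiv has_derivative_at_withinI[OF D[OF lW[OF that]]]]
      by (simp only: comp_assoc)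
    from cont deriv show ?thesis by blast
  qed
  ultimately have "C1_curve_on charts 0 1 ?\<gamma>"
    unfolding C1_curve_on_def by blast
  then have "piecewise_C1_curve charts ?\<gamma>"
    unfolding piecewise_C1_curve_def by (intro exI[of _ 1] exI[of _ real]) auto
  moreover have "?\<gamma> 0 = a" "?\<gamma> 1 = b"
    using ab homeo by (auto simp: l_def d_def homeomorphism_def)
  ultimately show ?thesis by blast
qed

text \<open>
  Any two points of a coordinate ball are joined by a coordinate segment, in either order. By
  concatenation, the set of points reachable from \<open>x\<close> therefore contains all of a
  coordinate ball as soon as it meets the ball, so it is open and closed.
\<close>

lemma (in riemannian_manifold) piecewise_C1_connected:
  "\<exists>\<gamma>. piecewise_C1_curve charts \<gamma> \<and> \<gamma> 0 = x \<and> \<gamma> 1 = y"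
proof -
  let ?R = "\<lambda>x y. \<exists>\<gamma>. piecewise_C1_curve charts \<gamma> \<and> \<gamma> 0 = x \<and> \<gamma> 1 = y"
  have trans: "?R x z" if "?R x y" "?R y z" for x y z
  proof -
    from that obtain \<gamma>1 \<gamma>2 where "piecewise_C1_curve charts \<gamma>1" "\<gamma>1 0 = x" "\<gamma>1 1 = y"
      "piecewise_C1_curve charts \<gamma>2" "\<gamma>2 0 = y" "\<gamma>2 1 = z" by blast
    then show ?thesis
      using piecewise_C1_curve_join[of charts \<gamma>1 \<gamma>2]
      by (intro exI[of _ "\<gamma>1 +++ \<gamma>2"]) (auto simp: joinpaths_def)
  qed
  have nbhd: "\<exists>T. open T \<and> p \<in> T \<and> (\<forall>a\<in>T. \<forall>b\<in>T. ?R a b)" for p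
  proof -
    obtain U \<phi> where U: "(U, \<phi>) \<in> charts" "p \<in> U" using charts_cover by fast
    have op: "open U" "open (\<phi> ` U)" and cont: "continuous_on U \<phi>"
      using chart_homeo[OF U(1)] by (auto simp: homeomorphism_def)
    then obtain e where e: "e > 0" "ball (\<phi> p) e \<subseteq> \<phi> ` U"
      using U(2) open_contains_ball by blast
    let ?T = "U \<inter> \<phi> -` ball (\<phi> p) e"
    have "?R a b" if "a \<in> ?T" "b \<in> ?T" for a b
    proof (rule coordinate_segment_C1[OF U(1)])
      have "closed_segment (\<phi> a) (\<phi> b) \<subseteq> ball (\<phi> p) e"
        using that by (intro closed_segment_subset convex_ball) auto
      with e show "closed_segment (\<phi> a) (\<phi> b) \<subseteq> \<phi> ` U" by blast
    qed (use that in auto)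
    moreover have "open ?T"
      using cont op by (intro continuous_open_preimage) auto
    ultimately show ?thesis using U e by (intro exI[of _ ?T]) auto
  qed
  show ?thesis
  proof (rule connected_induction_simple[OF connected_manifold, of x y "?R x"])
    show "?R x x" using nbhd[of x] by blast
    show "\<exists>T. openin (top_of_set UNIV) T \<and> a \<in> T \<and> (\<forall>p\<in>T. \<forall>q\<in>T. ?R x p \<longrightarrow> ?R x q)" for a
    proof -
      obtain T where T: "open T" "a \<in> T" "\<And>p q. p \<in> T \<Longrightarrow> q \<in> T \<Longrightarrow> ?R p q"
        using nbhd[of a] by blast
      have "\<forall>p\<in>T. \<forall>q\<in>T. ?R x p \<longrightarrow> ?R x q"
        using trans T(3) by meson
      moreover have "openin (top_of_set UNIV) T" using T(1) by simp
      ultimately show ?thesis using T(2) by (intro exI[of _ T] conjI)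
    qed
  qed (rule UNIV_I)+
qed

section \<open>Curve length and the triangle inequality\<close>

text \<open>
  One chart at \<open>p\<close> computes the speed of every curve whenever it passes through \<open>p\<close>. This makes
  the speeds of different curves at \<open>p\<close> comparable.
\<close>

lemma (in riemannian_manifold) curve_speed_cases:
  obtains U \<phi> where "(U, \<phi>) \<in> charts" "p \<in> U"
    "\<And>\<gamma> t. \<gamma> t = p \<Longrightarrow> curve_speed charts g \<gamma> t =
      sqrt (vector_derivative (\<phi> \<circ> \<gamma>) (at t) \<bullet> (g (U, \<phi>) p *v vector_derivative (\<phi> \<circ> \<gamma>) (at t)))"
proof -
  obtain U \<phi> where c: "(U, \<phi>) = (SOME (U, \<phi>). (U, \<phi>) \<in> charts \<and> p \<in> U)"
    by (rule prod.exhaust[of "SOME (U, \<phi>). (U, \<phi>) \<in> charts \<and> p \<in> U"]) (erule that[OF sym])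
  have "\<exists>c. case c of (U, \<phi>) \<Rightarrow> (U, \<phi>) \<in> charts \<and> p \<in> U"
    using charts_cover by fast
  from someI_ex[OF this] have "(U, \<phi>) \<in> charts" "p \<in> U"
    unfolding c[symmetric] by auto
  then show ?thesis
    by (rule that) (simp add: curve_speed_def c[symmetric] Let_def)
qed

lemma (in riemannian_manifold) curve_speed_nonneg: "curve_speed charts g \<gamma> t \<ge> 0"
proof -
  obtain U \<phi> where U: "(U, \<phi>) \<in> charts" "\<gamma> t \<in> U" and
    "\<And>\<gamma>' t'. \<gamma>' t' = \<gamma> t \<Longrightarrow> curve_speed charts g \<gamma>' t' =
      sqrt (vector_derivative (\<phi> \<circ> \<gamma>') (at t') \<bullet> (g (U, \<phi>) (\<gamma> t) *v vector_derivative (\<phi> \<circ> \<gamma>') (at t')))"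
    by (rule curve_speed_cases[of "\<gamma> t"]) blast
  moreover have "v \<bullet> (g (U, \<phi>) (\<gamma> t) *v v) \<ge> 0" for v
    using metric_pos_def[OF U, of v] by (cases "v = 0") auto
  ultimately show ?thesis by simp
qed

lemma (in riemannian_manifold) curve_length_nonneg: "curve_length charts g \<gamma> \<ge> 0"
  unfolding curve_length_def
  by (cases "curve_speed charts g \<gamma> integrable_on {0..1}")
    (auto intro!: integral_nonneg curve_speed_nonneg simp: not_integrable_integral)

text \<open>
  The chart in which the speed is computed is selected from the position alone. Hence a
  reparametrization does not change the chart, and its effect on the speed is the chain rule.
\<close>

lemma (in riemannian_manifold) curve_speed_affine:
  assumes m: "m > 0" and t: "t \<in> {a<..<b}"
    and \<delta>: "\<And>t. t \<in> {a..b} \<Longrightarrow> \<delta> t = \<gamma> (m * t + c)"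
    and diff: "\<And>U \<phi>. (U, \<phi>) \<in> charts \<Longrightarrow> \<gamma> (m * t + c) \<in> U \<Longrightarrow>
      ((\<phi> \<circ> \<gamma>) has_vector_derivative vector_derivative (\<phi> \<circ> \<gamma>) (at (m * t + c))) (at (m * t + c))"
  shows "curve_speed charts g \<delta> t = m * curve_speed charts g \<gamma> (m * t + c)"
proof -
  let ?h = "\<lambda>t. m * t + c"
  obtain U \<phi> where U: "(U, \<phi>) \<in> charts" "\<gamma> (?h t) \<in> U" and speed:
    "\<And>\<gamma>' t'. \<gamma>' t' = \<gamma> (?h t) \<Longrightarrow> curve_speed charts g \<gamma>' t' =
      sqrt (vector_derivative (\<phi> \<circ> \<gamma>') (at t') \<bullet> (g (U, \<phi>) (\<gamma> (?h t)) *v vector_derivative (\<phi> \<circ> \<gamma>') (at t')))"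
    by (rule curve_speed_cases[of "\<gamma> (?h t)"]) blast
  define v where "v = vector_derivative (\<phi> \<circ> \<gamma>) (at (?h t))"
  have "(?h has_vector_derivative m) (at t)"
    by (auto intro!: derivative_eq_intros simp: has_real_derivative_iff_has_vector_derivative[symmetric])
  then have "((\<phi> \<circ> \<gamma>) \<circ> ?h has_vector_derivative m *\<^sub>R v) (at t)"
    unfolding v_def using diff[OF U] by (rule vector_diff_chain_at)
  then have "((\<phi> \<circ> \<delta>) has_vector_derivative m *\<^sub>R v) (at t)"
    by (rule has_vector_derivative_transform_within_open[of _ _ _ "{a<..<b}"]) (use t \<delta> in auto)
  then have dv: "vector_derivative (\<phi> \<circ> \<delta>) (at t) = m *\<^sub>R v" by (rule vector_derivative_at)
  have "curve_speed charts g \<delta> t = sqrt ((m *\<^sub>R v) \<bullet> (g (U, \<phi>) (\<gamma> (?h t)) *v (m *\<^sub>R v)))"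
    using speed[of \<delta> t] \<delta>[of t] t dv by simp
  also have "\<dots> = sqrt (m\<^sup>2 * (v \<bullet> (g (U, \<phi>) (\<gamma> (?h t)) *v v)))"
    by (simp add: matrix_vector_mult_scaleR power2_eq_square algebra_simps)
  also have "\<dots> = m * curve_speed charts g \<gamma> (?h t)"
    using speed[of \<gamma> "?h t"] m by (simp add: real_sqrt_mult v_def)
  finally show ?thesis .
qed

lemma (in riemannian_manifold) integral_curve_speed_affine:
  assumes \<gamma>: "piecewise_C1_curve charts \<gamma>"
    and m: "m > 0" and ends: "m * a + c = 0" "m * b + c = 1"
    and \<delta>: "\<And>t. t \<in> {a..b} \<Longrightarrow> \<delta> t = \<gamma> (m * t + c)"
    and int: "curve_speed charts g \<delta> integrable_on {a..b}"
  shows "integral {a..b} (curve_speed charts g \<delta>) = curve_length charts g \<gamma>"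
proof -
  let ?I = "integral {a..b} (curve_speed charts g \<delta>)"
  obtain S where S: "finite S" and diff:
    "\<And>t U \<phi>. t \<in> {0..1} - S \<Longrightarrow> (U, \<phi>) \<in> charts \<Longrightarrow> \<gamma> t \<in> U \<Longrightarrow>
      ((\<phi> \<circ> \<gamma>) has_vector_derivative vector_derivative (\<phi> \<circ> \<gamma>) (at t)) (at t)"
    using piecewise_C1_curve_differentiable[OF \<gamma>] by blast
  \<comment> \<open>Outside the preimages of the break points of \<open>\<gamma>\<close> and the two end points, the chain rule applies.\<close>
  let ?N = "(\<lambda>t. (t - c) / m) ` S \<union> {a, b}"
  have "((\<lambda>t. m * curve_speed charts g \<gamma> (m * t + c)) has_integral ?I) {a..b}"
  proof (rule has_integral_spike_finite[OF _ _ integrable_integral[OF int]])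
    show "finite ?N" using S by simp
    fix t assume t: "t \<in> {a..b} - ?N"
    have "m * a + c \<le> m * t + c" "m * t + c \<le> m * b + c"
      using t m by (auto intro!: mult_left_mono)
    moreover have "m * t + c \<notin> S"
    proof
      assume "m * t + c \<in> S"
      then have "(m * t + c - c) / m \<in> (\<lambda>t. (t - c) / m) ` S" by blast
      with t m show False by simp
    qed
    ultimately have "m * t + c \<in> {0..1} - S" using ends by simp
    from diff[OF this] show "m * curve_speed charts g \<gamma> (m * t + c) = curve_speed charts g \<delta> t"
      using t by (intro curve_speed_affine[where a=a and b=b and \<delta>=\<delta>, OF m _ \<delta>, symmetric]) auto
  qed
  then have "((\<lambda>t. curve_speed charts g \<gamma> (m * t + c)) has_integral ?I / m) (cbox a b)"
    using m has_integral_mult_right[of "\<lambda>t. m * curve_speed charts g \<gamma> (m * t + c)" ?I "{a..b}" "1 / m"]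
    by simp
  from has_integral_affinity[OF this, of "1 / m" "- c / m"] m
  have "(curve_speed charts g \<gamma> has_integral ?I) ((\<lambda>x. m * x + c) ` {a..b})"
    by (simp add: algebra_simps)
  moreover have "(\<lambda>x. m * x + c) ` {a..b} = {0..1}"
  proof -
    have "a \<le> b" using ends m by (smt (verit) mult_left_mono)
    then show ?thesis using m ends image_affinity_atLeastAtMost[of m c a b] by simp
  qed
  ultimately show ?thesis unfolding curve_length_def by (simp add: integral_unique)
qed

text \<open>
  If the speed of the concatenation is integrable, its integral splits at \<open>1 / 2\<close> into the two
  lengths. If it is not, its integral is \<open>0\<close> by convention and the inequality holds trivially.
\<close>

lemma (in riemannian_manifold) curve_length_join_le:
  assumes \<gamma>: "piecewise_C1_curve charts \<gamma>1" "piecewise_C1_curve charts \<gamma>2" and join: "\<gamma>1 1 = \<gamma>2 0"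
  shows "curve_length charts g (\<gamma>1 +++ \<gamma>2) \<le> curve_length charts g \<gamma>1 + curve_length charts g \<gamma>2"
proof (cases "curve_speed charts g (\<gamma>1 +++ \<gamma>2) integrable_on {0..1}")
  case True
  let ?s = "curve_speed charts g (\<gamma>1 +++ \<gamma>2)"
  have int: "?s integrable_on {0..1/2}" "?s integrable_on {1/2..1}"
    by (auto intro: integrable_on_subinterval[OF True])
  have 1: "integral {0..1/2} ?s = curve_length charts g \<gamma>1"
    by (rule integral_curve_speed_affine[OF \<gamma>(1) _ _ _ _ int(1), of 2 0]) (auto simp: joinpaths_def)
  have eq: "(\<gamma>1 +++ \<gamma>2) t = \<gamma>2 (2 * t + - 1)" if "t \<in> {1/2..1}" for t
    using that by (intro joinpaths_second_half[where ?\<gamma>1.0 = \<gamma>1 and ?\<gamma>2.0 = \<gamma>2, OF join]) simp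
  have 2: "integral {1/2..1} ?s = curve_length charts g \<gamma>2"
    by (rule integral_curve_speed_affine[OF \<gamma>(2) _ _ _ _ int(2), of 2 "-1"]) (use eq in auto)
  have "integral {0..1/2} ?s + integral {1/2..1} ?s = integral {0..1} ?s"
    by (rule Henstock_Kurzweil_Integration.integral_combine[OF _ _ True]) auto
  then show ?thesis unfolding 1 2 by (simp add: curve_length_def)
next
  case False
  then have "curve_length charts g (\<gamma>1 +++ \<gamma>2) = 0"
    by (simp add: curve_length_def not_integrable_integral)
  then show ?thesis using curve_length_nonneg[of \<gamma>1] curve_length_nonneg[of \<gamma>2] by simp
qed

lemma (in riemannian_manifold) riemannian_dist_triangle:
  "riemannian_dist charts g x z \<le> riemannian_dist charts g x y + riemannian_dist charts g y z"
proof -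
  let ?L = "\<lambda>x y. {curve_length charts g \<gamma> | \<gamma>. piecewise_C1_curve charts \<gamma> \<and> \<gamma> 0 = x \<and> \<gamma> 1 = y}"
  let ?d = "riemannian_dist charts g"
  have ne: "?L x y \<noteq> {}" for x y using piecewise_C1_connected[of x y] by blast
  have bdd: "bdd_below (?L x y)" for x y
    using curve_length_nonneg by (intro bdd_belowI[of _ 0]) auto
  have le: "?d x z \<le> l1 + l2" if "l1 \<in> ?L x y" "l2 \<in> ?L y z" for l1 l2
  proof -
    obtain \<gamma>1 where 1: "l1 = curve_length charts g \<gamma>1" "piecewise_C1_curve charts \<gamma>1" "\<gamma>1 0 = x" "\<gamma>1 1 = y"
      using \<open>l1 \<in> ?L x y\<close> by blast
    obtain \<gamma>2 where 2: "l2 = curve_length charts g \<gamma>2" "piecewise_C1_curve charts \<gamma>2" "\<gamma>2 0 = y" "\<gamma>2 1 = z"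
      using \<open>l2 \<in> ?L y z\<close> by blast
    have "piecewise_C1_curve charts (\<gamma>1 +++ \<gamma>2)" "(\<gamma>1 +++ \<gamma>2) 0 = x" "(\<gamma>1 +++ \<gamma>2) 1 = z"
      using 1 2 piecewise_C1_curve_join[of charts \<gamma>1 \<gamma>2] by (auto simp: joinpaths_def)
    then have "?d x z \<le> curve_length charts g (\<gamma>1 +++ \<gamma>2)"
      unfolding riemannian_dist_def by (intro cInf_lower bdd) blast
    also have "\<dots> \<le> l1 + l2" using curve_length_join_le[of \<gamma>1 \<gamma>2] 1 2 by simp
    finally show ?thesis .
  qed
  have "?d x z - l1 \<le> ?d y z" if "l1 \<in> ?L x y" for l1
    unfolding riemannian_dist_def[of charts g y z]
    by (rule cInf_greatest[OF ne]) (use le[OF that] in fastforce)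
  then have "?d x z - ?d y z \<le> ?d x y"
    unfolding riemannian_dist_def[of charts g x y]
    by (intro cInf_greatest[OF ne]) fastforce
  then show ?thesis by simp
qed

section \<open>Laplace distributions with nearby footpoints\<close>

text \<open>
  The integral of a nonnegative function is the supremum of the integrals of the simple functions
  below it, so a pointwise bound up to a constant factor passes to the integrals of arbitrary
  functions, measurable or not. It thus applies to the Laplace densities of any distance function.
\<close>

lemma nn_integral_le_cmult:
  assumes c: "c > 0" and le: "\<And>x. f x \<le> ennreal c * h x"
  shows "(\<integral>\<^sup>+x. f x \<partial>M) \<le> ennreal c * (\<integral>\<^sup>+x. h x \<partial>M)"
  unfolding nn_integral_def[of M f]
proof (rule SUP_least, clarify)
  fix s assume s: "simple_function M s" "s \<le> f"
  let ?r = "\<lambda>x. ennreal (1 / c) * s x"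
  have cancel: "ennreal c * (ennreal (1 / c) * u) = u" "ennreal (1 / c) * (ennreal c * u) = u" for u
  proof -
    have "ennreal c * ennreal (1 / c) = 1"
      using c by (simp add: ennreal_mult'[symmetric])
    then show "ennreal c * (ennreal (1 / c) * u) = u" "ennreal (1 / c) * (ennreal c * u) = u"
      by (metis mult.assoc mult.commute mult_1)+
  qed
  have [measurable]: "s \<in> borel_measurable M" using s by (rule_tac borel_measurable_simple_function)
  have "?r x \<le> h x" for x
  proof -
    have "s x \<le> ennreal c * h x" using s(2) le[of x] by (auto simp: le_fun_def intro: order_trans)
    then have "?r x \<le> ennreal (1 / c) * (ennreal c * h x)" by (intro mult_left_mono) auto
    then show ?thesis by (simp only: cancel)
  qed
  then have "ennreal c * (\<integral>\<^sup>+x. ?r x \<partial>M) \<le> ennreal c * (\<integral>\<^sup>+x. h x \<partial>M)"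
    by (intro mult_left_mono nn_integral_mono) auto
  moreover have "integral\<^sup>S M s = ennreal c * (\<integral>\<^sup>+x. ?r x \<partial>M)"
    using s by (simp add: nn_integral_cmult[symmetric] cancel nn_integral_eq_simple_integral)
  ultimately show "integral\<^sup>S M s \<le> ennreal c * (\<integral>\<^sup>+x. h x \<partial>M)" by simp
qed

lemma laplace_density_le:
  fixes \<rho> :: "'a \<Rightarrow> 'a \<Rightarrow> real"
  assumes tri: "\<And>x y z. \<rho> x z \<le> \<rho> x y + \<rho> y z" and near: "\<rho> \<eta>' \<eta> \<le> \<Delta>" and \<sigma>: "\<sigma> > 0"
  shows "ennreal (exp (- \<rho> \<eta> m / \<sigma>)) \<le> ennreal (exp (\<Delta> / \<sigma>)) * ennreal (exp (- \<rho> \<eta>' m / \<sigma>))"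
proof -
  have "- \<rho> \<eta> m \<le> \<Delta> + - \<rho> \<eta>' m" using tri[of \<eta>' m \<eta>] near by simp
  then have "- \<rho> \<eta> m / \<sigma> \<le> \<Delta> / \<sigma> + - \<rho> \<eta>' m / \<sigma>"
    using \<sigma> by (metis add_divide_distrib divide_right_mono less_imp_le)
  then have "exp (- \<rho> \<eta> m / \<sigma>) \<le> exp (\<Delta> / \<sigma>) * exp (- \<rho> \<eta>' m / \<sigma>)"
    by (simp only: exp_add[symmetric] exp_le_cancel_iff)
  then show ?thesis by (simp only: ennreal_mult''[symmetric] exp_ge_zero ennreal_leI)
qed

lemma laplace_const_le:
  fixes \<rho> :: "'a \<Rightarrow> 'a \<Rightarrow> real"
  assumes "\<And>x y z. \<rho> x z \<le> \<rho> x y + \<rho> y z" "\<rho> \<eta>' \<eta> \<le> \<Delta>" "\<sigma> > 0"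
  shows "laplace_const \<rho> \<mu> \<eta> \<sigma> \<le> ennreal (exp (\<Delta> / \<sigma>)) * laplace_const \<rho> \<mu> \<eta>' \<sigma>"
  unfolding laplace_const_def
  by (intro nn_integral_le_cmult laplace_density_le assms exp_gt_zero)

lemma laplace_distribution_le:
  fixes \<rho> :: "'a::topological_space \<Rightarrow> 'a \<Rightarrow> real"
  assumes P: "laplace_distribution \<rho> \<mu> \<eta> \<sigma> P" and P': "laplace_distribution \<rho> \<mu> \<eta>' \<sigma> P'"
    and tri: "\<And>x y z. \<rho> x z \<le> \<rho> x y + \<rho> y z" and near: "\<rho> \<eta>' \<eta> \<le> \<Delta>" and \<sigma>: "\<sigma> > 0"
    and const: "laplace_const \<rho> \<mu> \<eta>' \<sigma> \<le> ennreal (exp \<beta>) * laplace_const \<rho> \<mu> \<eta> \<sigma>"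
    and A: "A \<in> sets borel"
  shows "emeasure P A \<le> ennreal (exp (\<beta> + \<Delta> / \<sigma>)) * emeasure P' A"
proof -
  let ?C = "laplace_const \<rho> \<mu> \<eta> \<sigma>" and ?C' = "laplace_const \<rho> \<mu> \<eta>' \<sigma>"
  have C: "0 < ?C" "?C < \<infinity>" "0 < ?C'" "?C' < \<infinity>"
    using P P' by (auto simp: laplace_distribution_def)
  \<comment> \<open>Both constants are positive and finite, so inequalities may be inverted as in the reals.\<close>
  obtain r where r: "?C = ennreal r" "r > 0"
    using C by (cases ?C) auto
  obtain r' where r': "?C' = ennreal r'" "r' > 0"
    using C by (cases ?C') auto
  have "r' \<le> exp \<beta> * r"
    using const r r' by (simp add: ennreal_mult[symmetric])
  then have "inverse r \<le> exp \<beta> * inverse r'"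
    using r r' by (simp add: field_simps)
  then have inv: "inverse ?C \<le> ennreal (exp \<beta>) * inverse ?C'"
    using r r' by (simp add: inverse_ennreal ennreal_mult[symmetric])
  have "inverse ?C * ennreal (exp (- \<rho> \<eta> m / \<sigma>)) * indicator A m
      \<le> ennreal (exp (\<beta> + \<Delta> / \<sigma>)) * (inverse ?C' * ennreal (exp (- \<rho> \<eta>' m / \<sigma>)) * indicator A m)" for m
  proof -
    have "inverse ?C * ennreal (exp (- \<rho> \<eta> m / \<sigma>))
      \<le> (ennreal (exp \<beta>) * inverse ?C') * (ennreal (exp (\<Delta> / \<sigma>)) * ennreal (exp (- \<rho> \<eta>' m / \<sigma>)))"
      using inv laplace_density_le[where \<rho>=\<rho>, OF tri near \<sigma>] by (rule mult_mono) auto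
    also have "\<dots> = ennreal (exp (\<beta> + \<Delta> / \<sigma>)) * (inverse ?C' * ennreal (exp (- \<rho> \<eta>' m / \<sigma>)))"
      by (simp add: exp_add ennreal_mult ac_simps)
    finally show ?thesis by (cases "m \<in> A") auto
  qed
  then show ?thesis
    using P P' A unfolding laplace_distribution_def
    by (auto intro!: nn_integral_le_cmult)
qed

text \<open>
  The privacy loss is the sum of the cost \<open>\<beta>\<close> of the changing normalizing constant and the cost
  \<open>\<Delta> / \<sigma>\<close> of the changing exponential. In general \<open>\<beta>\<close> is again \<open>\<Delta> / \<sigma>\<close>; it is \<open>0\<close> if the
  constant is the same at all footpoints. Adjacency is symmetric, so that the sensitivity bounds
  the distance of the footpoints in both directions: one bound goes into each of the two costs.
\<close>

lemma laplace_mechanism_differentially_private: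
  fixes \<rho> :: "'a::topological_space \<Rightarrow> 'a \<Rightarrow> real"
  assumes mech: "laplace_mechanism \<rho> \<mu> X n f \<sigma> \<Omega> F"
    and sens: "has_global_sensitivity \<rho> X n f \<Delta>"
    and tri: "\<And>x y z. \<rho> x z \<le> \<rho> x y + \<rho> y z" and \<sigma>: "\<sigma> > 0"
    and const: "\<And>\<eta> \<eta>'. \<rho> \<eta> \<eta>' \<le> \<Delta> \<Longrightarrow>
      laplace_const \<rho> \<mu> \<eta>' \<sigma> \<le> ennreal (exp \<beta>) * laplace_const \<rho> \<mu> \<eta> \<sigma>"
  shows "differentially_private (\<beta> + \<Delta> / \<sigma>) X n \<Omega> F"
proof -
  have rs: "randomized_summary X n \<Omega> F" using mech by (simp add: laplace_mechanism_def)
  have "\<P>(\<omega> in \<Omega> D. F D \<omega> \<in> A) \<le> exp (\<beta> + \<Delta> / \<sigma>) * \<P>(\<omega> in \<Omega> D'. F D' \<omega> \<in> A)"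
    if D: "D \<in> datasets X n" "D' \<in> datasets X n" and adj: "adjacent n D D'" and A: "A \<in> sets borel"
    for D D' A
  proof -
    have "adjacent n D' D" using adj by (simp add: adjacent_def eq_commute)
    then have near: "\<rho> (f D) (f D') \<le> \<Delta>" "\<rho> (f D') (f D) \<le> \<Delta>"
      using sens D adj by (auto simp: has_global_sensitivity_def)
    have em: "emeasure (distr (\<Omega> E) borel (F E)) A = ennreal \<P>(\<omega> in \<Omega> E. F E \<omega> \<in> A)"
      if "E \<in> datasets X n" for E
    proof -
      have E: "prob_space (\<Omega> E)" "F E \<in> \<Omega> E \<rightarrow>\<^sub>M borel"
        using rs that by (auto simp: randomized_summary_def)
      interpret prob_space "\<Omega> E" by (fact E)
      have "F E -` A \<inter> space (\<Omega> E) = {\<omega> \<in> space (\<Omega> E). F E \<omega> \<in> A}" by blast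
      with E A show ?thesis by (simp add: emeasure_distr emeasure_eq_measure)
    qed
    have "emeasure (distr (\<Omega> D) borel (F D)) A
        \<le> ennreal (exp (\<beta> + \<Delta> / \<sigma>)) * emeasure (distr (\<Omega> D') borel (F D')) A"
      using mech D by (intro laplace_distribution_le[where \<rho>=\<rho>, OF _ _ tri near(2) \<sigma> const[OF near(1)] A])
        (auto simp: laplace_mechanism_def)
    then show ?thesis by (simp add: em D ennreal_mult[symmetric])
  qed
  with rs show ?thesis by (simp add: differentially_private_def)
qed

theorem theorem1:
  fixes charts :: "('a::{t2_space, second_countable_topology}, 'n::finite) chart set"
    and g :: "('a, 'n) metric_coords"
    and \<rho> :: "'a \<Rightarrow> 'a \<Rightarrow> real"
    and \<mu> :: "'a measure"
    and X :: "'x set" and n :: nat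
    and f :: "(nat \<Rightarrow> 'x) \<Rightarrow> 'a"
    and \<Delta> \<epsilon> :: real
  assumes "complete_riemannian_manifold charts g"
    and "\<rho> = riemannian_dist charts g"
    and "riemannian_volume charts g \<mu>"
    and "n \<ge> 1"
    and "has_global_sensitivity \<rho> X n f \<Delta>"
    and "0 < \<Delta>"
    and "0 < \<epsilon>"
  shows
    "(\<forall>(\<Omega> :: (nat \<Rightarrow> 'x) \<Rightarrow> 'w measure) F.
        laplace_mechanism \<rho> \<mu> X n f (2 * \<Delta> / \<epsilon>) \<Omega> F \<longrightarrow> differentially_private \<epsilon> X n \<Omega> F) \<and>
     ((\<forall>\<eta> \<eta>'. laplace_const \<rho> \<mu> \<eta> (\<Delta> / \<epsilon>) = laplace_const \<rho> \<mu> \<eta>' (\<Delta> / \<epsilon>)) \<longrightarrow>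
      (\<forall>(\<Omega> :: (nat \<Rightarrow> 'x) \<Rightarrow> 'w measure) F.
        laplace_mechanism \<rho> \<mu> X n f (\<Delta> / \<epsilon>) \<Omega> F \<longrightarrow> differentially_private \<epsilon> X n \<Omega> F))"
proof -
  interpret riemannian_manifold charts g
    using assms(1) by (simp add: complete_riemannian_manifold_def)
  have tri: "\<rho> x z \<le> \<rho> x y + \<rho> y z" for x y z
    unfolding assms(2) by (rule riemannian_dist_triangle)
  note dp = laplace_mechanism_differentially_private[where \<rho>=\<rho>, OF _ assms(5) tri]
  have "differentially_private \<epsilon> X n \<Omega> F"
    if "laplace_mechanism \<rho> \<mu> X n f (2 * \<Delta> / \<epsilon>) \<Omega> F" for \<Omega> :: "(nat \<Rightarrow> 'x) \<Rightarrow> 'w measure" and F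
  proof -
    have pos: "2 * \<Delta> / \<epsilon> > 0" and rate: "\<Delta> / (2 * \<Delta> / \<epsilon>) = \<epsilon> / 2" using assms(6,7) by auto
    have "differentially_private (\<Delta> / (2 * \<Delta> / \<epsilon>) + \<Delta> / (2 * \<Delta> / \<epsilon>)) X n \<Omega> F"
      by (rule dp[OF that pos]) (rule laplace_const_le[where \<rho>=\<rho>, OF tri _ pos])
    then show ?thesis unfolding rate by simp
  qed
  moreover have "differentially_private \<epsilon> X n \<Omega> F"
    if const: "\<forall>\<eta> \<eta>'. laplace_const \<rho> \<mu> \<eta> (\<Delta> / \<epsilon>) = laplace_const \<rho> \<mu> \<eta>' (\<Delta> / \<epsilon>)"
      and "laplace_mechanism \<rho> \<mu> X n f (\<Delta> / \<epsilon>) \<Omega> F" for \<Omega> :: "(nat \<Rightarrow> 'x) \<Rightarrow> 'w measure" and F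
  proof -
    have pos: "\<Delta> / \<epsilon> > 0" using assms(6,7) by simp
    have "differentially_private (0 + \<Delta> / (\<Delta> / \<epsilon>)) X n \<Omega> F"
      by (rule dp[OF that(2) pos]) (metis const exp_zero ennreal_1 mult_1 order_refl)
    then show ?thesis using assms(6,7) by simp
  qed
  ultimately show ?thesis by blast
qed

end
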